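(* Let $n \in \mathbb{N}$ with $n > 1$, let $\lambda_1, \ldots, \lambda_n > 0$, let $a_1,\ldots,a_n \in \mathbb{R}$ and let $z$ be an integer with $1 \le z \le n-1$ such that $$a_1 < \cdots < a_z < \frac{\lambda_1 a_1 + \cdots + \lambda_n a_n}{\lambda_1 + \cdots + \lambda_n} < a_{z+1} < \cdots < a_n.$$ Then there are unique 1. $m \in \mathbb{N}$ such that $n/2 + |z - n/2| \le m \le n-1$, 2. surjective functions $i : \{1,\ldots,m\} \to \{1,\ldots,z\}$, $s \mapsto i_s$, and $j : \{1,\ldots,m\} \to \{z+1,\ldots,n\}$, $s \mapsto j_s$, where $i_s$ is decreasing in $s$ and $j_s$ is increasing in $s$, such that $j_s - i_s$ is strictly increasing in $s$, 3. $p_s, q_s > 0$, $s = 1, \ldots, m$, such that $$(\lambda_1,\ldots,\lambda_n)^T = \sum_{s=1}^m \left( p_s e_{i_s} + q_s e_{j_s} \right)$$ and $$\frac{p_s a_{i_s} + q_s a_{j_s}}{p_s + q_s} = \frac{\lambda_1 a_1 + \cdots + \lambda_n a_n}{\lambda_1 + \cdots + \lambda_n}, \quad s = 1,\ldots,m.$$ (Uniqueness is of the whole tuple consisting of $m$, $i$, $j$ and the numbers $p_s, q_s$.)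
   Context: "Increasing" means nondecreasing and "decreasing" means nonincreasing. $e_k$ denotes the $k$-th standard basis column vector of $\mathbb{R}^n$. *)

theory Defs
  imports Complex_Main "HOL-Library.FuncSet"
begin

text \<open>
  A vector of \<open>\<real>\<^sup>n\<close> is a function on \<open>nat\<close> of which only the values at \<open>1, \<dots>, n\<close> matter;
  equality of vectors is equality at these indices.
\<close>

definition std_basis :: "nat \<Rightarrow> nat \<Rightarrow> real" where
  "std_basis k = (\<lambda>l. if l = k then 1 else 0)"

definition weighted_mean :: "nat \<Rightarrow> (nat \<Rightarrow> real) \<Rightarrow> (nat \<Rightarrow> real) \<Rightarrow> real" where
  "weighted_mean n w a = (\<Sum>k=1..n. w k * a k) / (\<Sum>k=1..n. w k)"

end

theory Submission imports Defs
begin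

text \<open>
  Let \<open>\<mu>\<close> be the weighted mean. The mean condition for a pair \<open>(i\<^sub>s, j\<^sub>s)\<close> says that the moments
  \<open>p\<^sub>s (\<mu> - a (i\<^sub>s))\<close> and \<open>q\<^sub>s (a (j\<^sub>s) - \<mu>)\<close> are the same number \<open>t\<^sub>s > 0\<close>. Since \<open>p\<close> and \<open>q\<close> can be
  recovered from \<open>t\<close>, the sought decomposition is a common refinement of two ways of writing the
  total moment \<open>M\<close> as a sum: as the moments of the points \<open>z, z - 1, \<dots>, 1\<close> below \<open>\<mu>\<close>, and as the
  moments of the points \<open>z + 1, \<dots>, n\<close> above it. By definition of \<open>\<mu>\<close> both totals agree
  (\<open>balanced_about_weighted_mean\<close>).

  Both lists of moments cut the interval \<open>[0, M]\<close> into consecutive segments, and so does \<open>t\<close>.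
  Monotonicity of \<open>i\<close> and \<open>j\<close> makes every cut of the two coarse subdivisions a cut of the one given
  by \<open>t\<close>, and then the \<open>s\<close>-th fine segment lies in the coarse segments that \<open>i\<^sub>s\<close> and \<open>j\<^sub>s\<close> name
  (\<open>fills_iff\<close>). That \<open>j\<^sub>s - i\<^sub>s\<close> increases strictly means that between any two consecutive fine
  segments one of the two indices changes, so there are no superfluous cuts (\<open>staircase_iff\<close>).
  Hence the set of fine cuts is exactly the union of the two sets of coarse cuts. Listing this set
  in increasing order gives existence, and a finite set of reals has only one such listing, which
  gives uniqueness. The bounds on \<open>m\<close> follow by counting the values of \<open>i\<close>, \<open>j\<close> and \<open>j - i\<close>.
\<close>

section \<open>Refining a subdivision of an interval\<close>

text \<open>
  The positive numbers \<open>t 1, \<dots>, t m\<close>, laid out as consecutive segments, refine the segments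
  \<open>x 1, \<dots>, x u\<close>, and \<open>f s\<close> is the number of the coarse segment that contains the \<open>s\<close>-th fine one.
\<close>
definition fills :: "nat \<Rightarrow> (nat \<Rightarrow> real) \<Rightarrow> nat \<Rightarrow> (nat \<Rightarrow> real) \<Rightarrow> (nat \<Rightarrow> nat) \<Rightarrow> bool" where
  "fills m t u x f \<longleftrightarrow> f ` {1..m} = {1..u} \<and> mono_on {1..m} f \<and>
     (\<forall>k\<in>{1..u}. sum t {s\<in>{1..m}. f s = k} = x k)"

lemma partial_sums_less_iff:
  fixes t :: "nat \<Rightarrow> real"
  assumes "\<And>s. s \<in> {1..m} \<Longrightarrow> t s > 0" and "r \<le> m" and "s \<le> m"
  shows "sum t {1..r} < sum t {1..s} \<longleftrightarrow> r < s"
proof -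
  have less: "sum t {1..r} < sum t {1..s}" if "r < s" "s \<le> m" for r s
    by (rule sum_strict_mono2[where b = s]) (use that assms(1) in \<open>auto intro!: less_imp_le\<close>)
  show ?thesis
    using less[of r s] less[of s r] assms(2,3) by (cases r s rule: linorder_cases) auto
qed

lemma partial_sums_le_iff:
  fixes t :: "nat \<Rightarrow> real"
  assumes "\<And>s. s \<in> {1..m} \<Longrightarrow> t s > 0" and "r \<le> m" and "s \<le> m"
  shows "sum t {1..r} \<le> sum t {1..s} \<longleftrightarrow> r \<le> s"
  using partial_sums_less_iff[OF assms(1) assms(3,2)] by (simp add: not_less [symmetric])

text \<open>
  In terms of cuts: as \<open>f\<close> is monotone, the fine segments numbered at most \<open>k\<close> by \<open>f\<close> form an
  initial block, whose right end is the \<open>k\<close>-th coarse cut. So \<open>f\<close> is determined by the two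
  sequences of partial sums. Using \<open>f s \<le> k\<close> for all \<open>k \<le> u\<close> instead of \<open>f s = k\<close> also encodes
  that \<open>f s\<close> lies between \<open>1\<close> (case \<open>k = 0\<close>) and \<open>u\<close> (case \<open>k = u\<close>).
\<close>
lemma fills_iff:
  fixes t x :: "nat \<Rightarrow> real"
  assumes t: "\<And>s. s \<in> {1..m} \<Longrightarrow> t s > 0" and x: "\<And>k. k \<in> {1..u} \<Longrightarrow> x k > 0"
  shows "fills m t u x f \<longleftrightarrow>
    sum x {1..u} = sum t {1..m} \<and>
    (\<lambda>k. sum x {1..k}) ` {..u} \<subseteq> (\<lambda>s. sum t {1..s}) ` {..m} \<and>
    (\<forall>s\<in>{1..m}. \<forall>k\<le>u. f s \<le> k \<longleftrightarrow> sum t {1..s} \<le> sum x {1..k})"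
    (is "_ \<longleftrightarrow> ?total \<and> ?cuts \<and> ?position")
proof
  assume "fills m t u x f"
  then have onto: "f ` {1..m} = {1..u}" and mono: "mono_on {1..m} f"
    and fibre: "\<And>k. k \<in> {1..u} \<Longrightarrow> sum t {s\<in>{1..m}. f s = k} = x k"
    by (auto simp: fills_def)
  have sum_le: "sum x {1..k} = sum t {s\<in>{1..m}. f s \<le> k}" if "k \<le> u" for k
  proof -
    have "sum x {1..k} = (\<Sum>k'\<in>{1..k}. sum t {s\<in>{s\<in>{1..m}. f s \<le> k}. f s = k'})"
    proof (rule sum.cong)
      fix k' assume k': "k' \<in> {1..k}"
      then have "{s\<in>{s\<in>{1..m}. f s \<le> k}. f s = k'} = {s\<in>{1..m}. f s = k'}" by auto
      with fibre[of k'] k' that show "x k' = sum t {s\<in>{s\<in>{1..m}. f s \<le> k}. f s = k'}" by simp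
    qed simp
    also have "\<dots> = sum t {s\<in>{1..m}. f s \<le> k}"
      by (rule sum.group) (use onto in auto)
    finally show ?thesis .
  qed
  have cut: "\<exists>r\<le>m. sum x {1..k} = sum t {1..r} \<and> (\<forall>s\<in>{1..m}. f s \<le> k \<longleftrightarrow> s \<le> r)"
    if "k \<le> u" for k
  proof -
    define S where "S = {s\<in>{1..m}. f s \<le> k}"
    \<comment> \<open>\<open>0\<close> covers an empty block, which occurs for \<open>k = 0\<close>\<close>
    define r where "r = Max (insert 0 S)"
    have fin: "finite (insert 0 S)" by (simp add: S_def)
    have r: "r \<in> insert 0 S" unfolding r_def using fin by (rule Max_in) simp
    then have "r \<le> m" by (auto simp: S_def)
    have max: "s \<le> r" if "s \<in> S" for s unfolding r_def using fin that by simp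
    have down: "s \<in> S" if "s \<in> {1..r}" "r \<in> S" for s
      using that monotone_onD[OF mono, of s r] by (auto simp: S_def)
    have "S = {1..r}"
    proof
      show "S \<subseteq> {1..r}" using max by (auto simp: S_def)
      show "{1..r} \<subseteq> S"
      proof
        fix s assume s: "s \<in> {1..r}"
        then have "r \<in> S" using r by auto
        with s show "s \<in> S" by (rule down)
      qed
    qed
    then have "sum x {1..k} = sum t {1..r}"
      using sum_le[OF that] by (simp only: S_def)
    moreover have "f s \<le> k \<longleftrightarrow> s \<le> r" if "s \<in> {1..m}" for s
    proof -
      have "f s \<le> k \<longleftrightarrow> s \<in> S" using that by (simp add: S_def)
      also have "\<dots> \<longleftrightarrow> s \<le> r" using that by (simp add: \<open>S = {1..r}\<close>)
      finally show ?thesis .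
    qed
    ultimately show ?thesis using \<open>r \<le> m\<close> by blast
  qed
  have ?total using sum_le[of u] onto by (auto intro!: arg_cong[where f = "sum t"])
  moreover have ?cuts using cut by fastforce
  moreover have ?position
  proof (intro ballI allI impI)
    fix s k assume s: "s \<in> {1..m}" and "k \<le> u"
    then obtain r where "r \<le> m" "sum x {1..k} = sum t {1..r}" "f s \<le> k \<longleftrightarrow> s \<le> r"
      using cut by blast
    then show "f s \<le> k \<longleftrightarrow> sum t {1..s} \<le> sum x {1..k}"
      using s partial_sums_le_iff[of m t s r] t by auto
  qed
  ultimately show "?total \<and> ?cuts \<and> ?position" by blast
next
  assume rhs: "?total \<and> ?cuts \<and> ?position"
  then have position: "f s \<le> k \<longleftrightarrow> sum t {1..s} \<le> sum x {1..k}" if "s \<in> {1..m}" "k \<le> u" for s k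
    using that by blast
  have cut: "\<exists>r\<le>m. sum x {1..k} = sum t {1..r}" if "k \<le> u" for k
    using rhs that by auto
  have le: "f s \<le> k \<longleftrightarrow> s \<le> r"
    if "s \<in> {1..m}" "k \<le> u" "r \<le> m" "sum x {1..k} = sum t {1..r}" for s k r
    using that partial_sums_le_iff[of m t s r] t position by auto
  have range: "f s \<in> {1..u}" if "s \<in> {1..m}" for s
  proof -
    have "sum x {1..u} = sum t {1..m}" using rhs by blast
    then have "f s \<le> u" "\<not> f s \<le> 0" using le[of s u m] le[of s 0 0] that by simp_all
    then show ?thesis by simp
  qed
  have fibre: "{s\<in>{1..m}. f s = k} \<noteq> {} \<and> sum t {s\<in>{1..m}. f s = k} = x k" if "k \<in> {1..u}" for k
  proof -
    have "k \<le> u" "k - 1 \<le> u" using that by auto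
    from cut[OF this(1)] obtain r where r: "r \<le> m" "sum x {1..k} = sum t {1..r}" by blast
    from cut[OF \<open>k - 1 \<le> u\<close>] obtain r' where r': "r' \<le> m" "sum x {1..k-1} = sum t {1..r'}"
      by blast
    have "sum x {1..k} = sum x {1..k-1} + x k"
      using that by (cases k) auto
    with r r' x[OF that] have diff: "sum t {1..r} = sum t {1..r'} + x k" and "r' < r"
      using partial_sums_less_iff[of m t r' r] t by auto
    have "{s\<in>{1..m}. f s = k} = {r'<..r}"
    proof (intro set_eqI)
      fix s
      show "s \<in> {s\<in>{1..m}. f s = k} \<longleftrightarrow> s \<in> {r'<..r}"
      proof (cases "s \<in> {1..m}")
        case True
        then have "f s \<le> k \<longleftrightarrow> s \<le> r" "f s \<le> k - 1 \<longleftrightarrow> s \<le> r'"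
          using le[of s k r] le[of s "k - 1" r'] r r' \<open>k \<le> u\<close> \<open>k - 1 \<le> u\<close> by blast+
        moreover have "f s = k \<longleftrightarrow> f s \<le> k \<and> \<not> f s \<le> k - 1" using that by auto
        ultimately show ?thesis using True by auto
      next
        case False
        then show ?thesis using r(1) by auto
      qed
    qed
    moreover have "sum t {1..r} = sum t {1..r'} + sum t {r'<..r}"
      using \<open>r' < r\<close> by (subst sum.union_disjoint [symmetric]) (auto intro!: sum.cong)
    ultimately show ?thesis using diff \<open>r' < r\<close> by auto
  qed
  have "mono_on {1..m} f"
  proof (rule monotone_onI)
    fix s s' assume s: "s \<in> {1..m}" "s' \<in> {1..m}" "s \<le> s'"
    then have "sum t {1..s} \<le> sum t {1..s'}" using partial_sums_le_iff[of m t s s'] t by auto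
    also have "\<dots> \<le> sum x {1..f s'}" using position[of s' "f s'"] range s by auto
    finally show "f s \<le> f s'" using position[of s "f s'"] range s by auto
  qed
  moreover have "f ` {1..m} = {1..u}"
    using range fibre by blast
  ultimately show "fills m t u x f" using fibre by (auto simp: fills_def)
qed

lemma mono_sum_strict_mono_on_iff:
  fixes f g :: "nat \<Rightarrow> nat"
  assumes "mono_on {1..m} f" and "mono_on {1..m} g"
  shows "strict_mono_on {1..m} (\<lambda>s. f s + g s) \<longleftrightarrow>
    (\<forall>s. 1 \<le> s \<and> s < m \<longrightarrow> f s < f (Suc s) \<or> g s < g (Suc s))"
proof
  assume "strict_mono_on {1..m} (\<lambda>s. f s + g s)"
  then show "\<forall>s. 1 \<le> s \<and> s < m \<longrightarrow> f s < f (Suc s) \<or> g s < g (Suc s)"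
    by (force dest: monotone_onD[where y = "Suc _"])
next
  assume step: "\<forall>s. 1 \<le> s \<and> s < m \<longrightarrow> f s < f (Suc s) \<or> g s < g (Suc s)"
  show "strict_mono_on {1..m} (\<lambda>s. f s + g s)"
  proof (rule monotone_onI)
    fix r s assume rs: "r \<in> {1..m}" "s \<in> {1..m}" "r < s"
    have "f r \<le> f (Suc r)" "g r \<le> g (Suc r)" "f (Suc r) \<le> f s" "g (Suc r) \<le> g s"
      using rs by (auto intro!: monotone_onD[OF assms(1)] monotone_onD[OF assms(2)])
    with step rs show "f r + g r < f s + g s"
      by (metis add_le_less_mono add_less_le_mono atLeastAtMost_iff le_trans less_le_trans)
  qed
qed

section \<open>The coarsest common refinement\<close>

text \<open>
  The cells \<open>(f s, g s)\<close> with masses \<open>t s\<close> are the transport plan between \<open>x\<close> and \<open>y\<close> produced by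
  the north-west corner rule. Strict growth of \<open>f + g\<close> forbids splitting one cell into two steps.
\<close>
definition staircase ::
  "nat \<Rightarrow> (nat \<Rightarrow> real) \<Rightarrow> nat \<Rightarrow> (nat \<Rightarrow> real) \<Rightarrow> (nat \<Rightarrow> nat) \<Rightarrow>
   nat \<Rightarrow> (nat \<Rightarrow> real) \<Rightarrow> (nat \<Rightarrow> nat) \<Rightarrow> bool" where
  "staircase m t u x f v y g \<longleftrightarrow>
     fills m t u x f \<and> fills m t v y g \<and> strict_mono_on {1..m} (\<lambda>s. f s + g s)"

text \<open>
  For \<open>1 \<le> s < m\<close>, the end of the \<open>s\<close>-th fine segment is a cut of \<open>x\<close> exactly when
  \<open>f s < f (s + 1)\<close>, and a cut of \<open>y\<close> exactly when \<open>g s < g (s + 1)\<close>. So strict growth of \<open>f + g\<close>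
  says that every interior fine cut is a coarse cut; the two end points are coarse cuts anyway.
\<close>
lemma staircase_iff:
  fixes t x y :: "nat \<Rightarrow> real"
  assumes t: "\<And>s. s \<in> {1..m} \<Longrightarrow> t s > 0"
    and x: "\<And>k. k \<in> {1..u} \<Longrightarrow> x k > 0" and y: "\<And>k. k \<in> {1..v} \<Longrightarrow> y k > 0"
  shows "staircase m t u x f v y g \<longleftrightarrow>
    sum x {1..u} = sum t {1..m} \<and> sum y {1..v} = sum t {1..m} \<and>
    (\<lambda>s. sum t {1..s}) ` {..m} = (\<lambda>k. sum x {1..k}) ` {..u} \<union> (\<lambda>k. sum y {1..k}) ` {..v} \<and>
    (\<forall>s\<in>{1..m}. \<forall>k\<le>u. f s \<le> k \<longleftrightarrow> sum t {1..s} \<le> sum x {1..k}) \<and>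
    (\<forall>s\<in>{1..m}. \<forall>k\<le>v. g s \<le> k \<longleftrightarrow> sum t {1..s} \<le> sum y {1..k})"
proof -
  have strict: "strict_mono_on {1..m} (\<lambda>s. f s + g s) \<longleftrightarrow>
      (\<lambda>s. sum t {1..s}) ` {..m} \<subseteq> (\<lambda>k. sum x {1..k}) ` {..u} \<union> (\<lambda>k. sum y {1..k}) ` {..v}"
    if f: "fills m t u x f" and g: "fills m t v y g"
  proof -
    let ?T = "\<lambda>s. sum t {1..s}"
    have mono: "mono_on {1..m} f" "mono_on {1..m} g" using f g by (auto simp: fills_def)
    have step: "h s < h (Suc s) \<longleftrightarrow> ?T s \<in> (\<lambda>k. sum w {1..k}) ` {..b}"
      if h: "fills m t b w h" and w: "\<And>k. k \<in> {1..b} \<Longrightarrow> w k > 0" and s: "1 \<le> s" "s < m"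
      for b w h s
    proof -
      have position: "h r \<le> k \<longleftrightarrow> ?T r \<le> sum w {1..k}" if "r \<in> {1..m}" "k \<le> b" for r k
        using iffD1[OF fills_iff[OF t w] h] that by blast
      show ?thesis
      proof
        assume less: "h s < h (Suc s)"
        have b: "h s \<le> b" using h s by (auto simp: fills_def)
        then obtain r where r: "r \<le> m" "sum w {1..h s} = ?T r"
          using iffD1[OF fills_iff[OF t w] h] by force
        have "?T s \<le> ?T r" "\<not> ?T (Suc s) \<le> ?T r"
          using position[of s "h s"] position[of "Suc s" "h s"] less b s r by auto
        then have "s \<le> r" "\<not> Suc s \<le> r"
          using partial_sums_le_iff[of m t s r] partial_sums_le_iff[of m t "Suc s" r] t r s
          by (auto simp del: sum.cl_ivl_Suc)
        then have "r = s" by simp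
        with r b show "?T s \<in> (\<lambda>k. sum w {1..k}) ` {..b}" by (metis atMost_iff imageI)
      next
        assume "?T s \<in> (\<lambda>k. sum w {1..k}) ` {..b}"
        then obtain k where k: "k \<le> b" "?T s = sum w {1..k}" by auto
        then have "h s \<le> k" "\<not> h (Suc s) \<le> k"
          using position[of s k] position[of "Suc s" k] partial_sums_le_iff[of m t "Suc s" s] t s
          by auto
        then show "h s < h (Suc s)" by simp
      qed
    qed
    let ?C = "(\<lambda>k. sum x {1..k}) ` {..u} \<union> (\<lambda>k. sum y {1..k}) ` {..v}"
    have "?T 0 \<in> ?C" by (intro UnI1 image_eqI[of _ _ 0]) auto
    moreover have "?T m \<in> ?C"
      using iffD1[OF fills_iff[OF t x] f] by (intro UnI1 image_eqI[of _ _ u]) auto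
    moreover have "s = 0 \<or> s = m \<or> 1 \<le> s \<and> s < m" if "s \<le> m" for s using that by linarith
    ultimately have "?T ` {..m} \<subseteq> ?C \<longleftrightarrow> (\<forall>s. 1 \<le> s \<and> s < m \<longrightarrow> ?T s \<in> ?C)"
      unfolding image_subset_iff by (metis atMost_iff less_imp_le)
    then show ?thesis
      unfolding mono_sum_strict_mono_on_iff[OF mono] using step[OF f x] step[OF g y] by blast
  qed
  then have "staircase m t u x f v y g \<longleftrightarrow> fills m t u x f \<and> fills m t v y g \<and>
      (\<lambda>s. sum t {1..s}) ` {..m} \<subseteq> (\<lambda>k. sum x {1..k}) ` {..u} \<union> (\<lambda>k. sum y {1..k}) ` {..v}"
    unfolding staircase_def by metis
  then show ?thesis
    unfolding set_eq_subset Un_subset_iff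
    by (simp only: fills_iff[OF t x] fills_iff[OF t y])
      (intro iffI; elim conjE; intro conjI; assumption)
qed

lemma strict_mono_enumeration_unique:
  fixes T T' :: "nat \<Rightarrow> real"
  assumes "strict_mono_on {..m} T" and "strict_mono_on {..m'} T'" and "T ` {..m} = T' ` {..m'}"
  shows "m = m'" and "\<And>s. s \<le> m \<Longrightarrow> T s = T' s"
proof -
  have sorted: "sorted_wrt (<) (map T [0..<Suc m])" "sorted_wrt (<) (map T' [0..<Suc m'])"
    using assms(1,2) by (auto simp: sorted_wrt_iff_nth_less monotone_on_def simp del: upt_Suc)
  have "map T [0..<Suc m] = map T' [0..<Suc m']"
    by (rule sorted_distinct_set_unique)
      (use sorted assms(3) in \<open>auto simp: strict_sorted_iff atLeast0LessThan lessThan_Suc_atMost simp del: upt_Suc\<close>)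
  then show "m = m'" and "\<And>s. s \<le> m \<Longrightarrow> T s = T' s"
    by (auto simp: list_eq_iff_nth_eq simp del: upt_Suc)
qed

text \<open>
  The set of fine cuts depends on \<open>x\<close> and \<open>y\<close> alone, so its increasing enumeration is determined,
  and \<open>t\<close>, \<open>f\<close> and \<open>g\<close> are read off from it.
\<close>
lemma staircase_unique:
  fixes t t' x y :: "nat \<Rightarrow> real"
  assumes t: "\<And>s. s \<in> {1..m} \<Longrightarrow> t s > 0" and t': "\<And>s. s \<in> {1..m'} \<Longrightarrow> t' s > 0"
    and x: "\<And>k. k \<in> {1..u} \<Longrightarrow> x k > 0" and y: "\<And>k. k \<in> {1..v} \<Longrightarrow> y k > 0"
    and st: "staircase m t u x f v y g" and st': "staircase m' t' u x f' v y g'"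
  shows "m = m'" and "\<And>s. s \<in> {1..m} \<Longrightarrow> t s = t' s \<and> f s = f' s \<and> g s = g' s"
proof -
  note iff = iffD1[OF staircase_iff[OF t x y] st, simplified]
    and iff' = iffD1[OF staircase_iff[OF t' x y] st', simplified]
  have "strict_mono_on {..m} (\<lambda>s. sum t {1..s})" "strict_mono_on {..m'} (\<lambda>s. sum t' {1..s})"
    using partial_sums_less_iff[of m t] partial_sums_less_iff[of m' t'] t t'
    by (auto intro!: monotone_onI)
  from strict_mono_enumeration_unique[OF this] iff iff'
  have m: "m = m'" and T: "\<And>s. s \<le> m \<Longrightarrow> sum t {1..s} = sum t' {1..s}" by auto
  show "m = m'" by fact
  fix s assume s: "s \<in> {1..m}"
  have "t s = sum t {1..s} - sum t {1..s - 1}" "t' s = sum t' {1..s} - sum t' {1..s - 1}"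
    using s by (cases s; simp)+
  then have "t s = t' s" using T[of s] T[of "s - 1"] s by force
  moreover have range: "f s \<le> u" "f' s \<le> u" "g s \<le> v" "g' s \<le> v"
    using st st' s m by (auto simp: staircase_def fills_def)
  have "f s \<le> k \<longleftrightarrow> f' s \<le> k" if "k \<le> u" for k
    using iff iff' s that T[of s] m by auto
  from this[of "f s"] this[of "f' s"] have "f s = f' s" using range by auto
  moreover have "g s \<le> k \<longleftrightarrow> g' s \<le> k" if "k \<le> v" for k
    using iff iff' s that T[of s] m by auto
  from this[of "g s"] this[of "g' s"] have "g s = g' s" using range by auto
  ultimately show "t s = t' s \<and> f s = f' s \<and> g s = g' s" by blast
qed

lemma staircase_exists:
  fixes x y :: "nat \<Rightarrow> real"
  assumes x: "\<And>k. k \<in> {1..u} \<Longrightarrow> x k > 0" and y: "\<And>k. k \<in> {1..v} \<Longrightarrow> y k > 0"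
    and total: "sum x {1..u} = sum y {1..v}"
  obtains m t f g where "\<And>s. s \<in> {1..m} \<Longrightarrow> t s > 0" and "staircase m t u x f v y g"
proof -
  define A where "A = (\<lambda>k. sum x {1..k}) ` {..u} \<union> (\<lambda>k. sum y {1..k}) ` {..v}"
  have fin: "finite A" and "A \<noteq> {}" by (auto simp: A_def)
  \<comment> \<open>\<open>m\<close> segments have \<open>m + 1\<close> cuts\<close>
  define m where "m = card A - 1"
  have card: "card A = Suc m"
    using fin \<open>A \<noteq> {}\<close> by (simp add: m_def card_gt_0_iff)
  define T where "T = (\<lambda>s. sorted_list_of_set A ! s)"
  have less: "T r < T s" if "r < s" "s \<le> m" for r s
    using that fin card strict_sorted_list_of_set[of A]
    by (auto simp: T_def sorted_wrt_iff_nth_less)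
  then have le: "T r \<le> T s" if "r \<le> s" "s \<le> m" for r s
    using that by (metis le_neq_implies_less less_imp_le order_refl)
  have image: "T ` {..m} = A"
    using fin card nth_image[of "Suc m" "sorted_list_of_set A"]
    by (simp add: T_def atLeast0LessThan lessThan_Suc_atMost)
  have bounds: "0 \<le> c \<and> c \<le> sum x {1..u}" if "c \<in> A" for c
  proof -
    have "0 \<le> sum w {1..k} \<and> sum w {1..k} \<le> sum w {1..b}"
      if "k \<le> b" "\<And>k. k \<in> {1..b} \<Longrightarrow> w k > 0" for w :: "nat \<Rightarrow> real" and k b
      using that partial_sums_le_iff[of b w 0 k] partial_sums_le_iff[of b w k b] by simp
    from this[of _ u x] this[of _ v y] show ?thesis
      using that x y total by (auto simp: A_def)
  qed
  have "0 \<in> A" unfolding A_def by (intro UnI1 image_eqI[of _ _ 0]) auto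
  then obtain r where "r \<le> m" "T r = 0" using image by force
  then have T0: "T 0 = 0" using le[of 0 r] bounds image by force
  have "sum x {1..u} \<in> A" by (auto simp: A_def)
  then obtain r where "r \<le> m" "T r = sum x {1..u}" using image by force
  then have Tm: "T m = sum x {1..u}"
    using le[of r m] bounds[of "T m"] image by force
  define t where "t s = T s - T (s - 1)" for s
  have sum_t: "sum t {1..s} = T s" for s
    by (induction s) (auto simp: t_def T0)
  have t: "t s > 0" if "s \<in> {1..m}" for s
    using that less[of "s - 1" s] by (simp add: t_def)
  define f where "f s = (LEAST k. T s \<le> sum x {1..k})" for s
  define g where "g s = (LEAST k. T s \<le> sum y {1..k})" for s
  have position: "(LEAST k. c \<le> sum w {1..k}) \<le> k \<longleftrightarrow> c \<le> sum w {1..k}"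
    if "k \<le> b" "\<And>k. k \<in> {1..b} \<Longrightarrow> w k > 0" "c \<le> sum w {1..b}"
    for c :: real and w :: "nat \<Rightarrow> real" and k b
  proof
    assume "(LEAST k. c \<le> sum w {1..k}) \<le> k"
    then have "sum w {1..(LEAST k. c \<le> sum w {1..k})} \<le> sum w {1..k}"
      using partial_sums_le_iff[of b w _ k] that by auto
    moreover have "c \<le> sum w {1..(LEAST k. c \<le> sum w {1..k})}" using that(3) by (rule LeastI)
    ultimately show "c \<le> sum w {1..k}" by linarith
  qed (rule Least_le)
  have "T s \<le> sum x {1..u}" if "s \<le> m" for s using le[OF that] Tm by simp
  then have "staircase m t u x f v y g"
    using position[of _ u x] position[of _ v y] x y total Tm image
    by (intro iffD2[OF staircase_iff[OF t x y]]) (simp_all only: sum_t, auto simp: A_def f_def g_def)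
  with t show thesis by (rule that)
qed

text \<open>
  The values \<open>f s + g s\<close> are distinct and lie in \<open>{2..u + v}\<close>; this gives the upper bound.
\<close>
lemma staircase_bounds:
  assumes "staircase m t u x f v y g"
  shows "u \<le> m" and "v \<le> m" and "m \<le> u + v - 1"
proof -
  have f: "f ` {1..m} = {1..u}" and g: "g ` {1..m} = {1..v}"
    and strict: "strict_mono_on {1..m} (\<lambda>s. f s + g s)"
    using assms by (auto simp: staircase_def fills_def)
  show "u \<le> m" "v \<le> m" using card_image_le[of "{1..m}" f] card_image_le[of "{1..m}" g] f g by auto
  have "card {1..m} \<le> card {2..u + v}"
  proof (rule card_inj_on_le)
    show "inj_on (\<lambda>s. f s + g s) {1..m}" using strict by (rule strict_mono_on_imp_inj_on)
    have "f s \<in> {1..u} \<and> g s \<in> {1..v}" if "s \<in> {1..m}" for s using f g that by blast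
    then show "(\<lambda>s. f s + g s) ` {1..m} \<subseteq> {2..u + v}" by fastforce
  qed simp
  then show "m \<le> u + v - 1" by simp
qed

section \<open>From decompositions of weights to refinements of moments\<close>

text \<open>
  Within a fibre of \<open>h\<close> the lever arm \<open>c\<close> is constant, so decomposing the weight \<open>l k\<close> into the
  pieces \<open>w s\<close> is the same as decomposing the moment \<open>l k * c k\<close> into the moments of the pieces.
  The relabelling \<open>\<rho>\<close> serves to number the points on either side of the mean outwards from it.
\<close>
lemma fills_relabel:
  fixes w c l :: "_ \<Rightarrow> real"
  assumes bij: "bij_betw \<rho> {1..u} K" and c: "\<And>k. k \<in> K \<Longrightarrow> c k > 0"
    and f: "\<And>s. s \<in> {1..m} \<Longrightarrow> f s \<in> {1..u}"
    and h: "\<And>s. s \<in> {1..m} \<Longrightarrow> h s = \<rho> (f s)"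
    and t: "\<And>s. s \<in> {1..m} \<Longrightarrow> t s = w s * c (h s)"
  shows "fills m t u (\<lambda>k. l (\<rho> k) * c (\<rho> k)) f \<longleftrightarrow>
    h ` {1..m} = K \<and> mono_on {1..m} f \<and> (\<forall>k\<in>K. l k = sum w {s\<in>{1..m}. h s = k})"
proof -
  have inj: "inj_on \<rho> {1..u}" and K: "K = \<rho> ` {1..u}"
    using bij by (auto simp: bij_betw_def)
  have "h ` {1..m} = \<rho> ` f ` {1..m}" using h by (auto simp: image_image)
  then have onto: "h ` {1..m} = K \<longleftrightarrow> f ` {1..m} = {1..u}"
    unfolding K using inj_on_image_eq_iff[OF inj] f by (metis image_subsetI order_refl)
  have "sum t {s\<in>{1..m}. f s = k} = l (\<rho> k) * c (\<rho> k) \<longleftrightarrow>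
      l (\<rho> k) = sum w {s\<in>{1..m}. h s = \<rho> k}" if k: "k \<in> {1..u}" for k
  proof -
    have "{s\<in>{1..m}. f s = k} = {s\<in>{1..m}. h s = \<rho> k}"
      using h f k inj_onD[OF inj] by auto
    then have "sum t {s\<in>{1..m}. f s = k} = (\<Sum>s | s \<in> {1..m} \<and> h s = \<rho> k. w s * c (\<rho> k))"
      using t by (intro sum.cong) auto
    also have "\<dots> = sum w {s\<in>{1..m}. h s = \<rho> k} * c (\<rho> k)" by (simp add: sum_distrib_right)
    finally show ?thesis using c[of "\<rho> k"] k K by auto
  qed
  then show ?thesis unfolding fills_def onto by (auto simp: K)
qed

definition paired_decomposition ::
  "nat \<Rightarrow> nat \<Rightarrow> (nat \<Rightarrow> real) \<Rightarrow> (nat \<Rightarrow> real) \<Rightarrow> real \<Rightarrow>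
   nat \<Rightarrow> (nat \<Rightarrow> nat) \<Rightarrow> (nat \<Rightarrow> nat) \<Rightarrow> (nat \<Rightarrow> real) \<Rightarrow> (nat \<Rightarrow> real) \<Rightarrow> bool" where
  "paired_decomposition n z lam a \<mu> m i j p q \<longleftrightarrow>
     i ` {1..m} = {1..z} \<and> j ` {1..m} = {z+1..n} \<and>
     antimono_on {1..m} i \<and> mono_on {1..m} j \<and>
     strict_mono_on {1..m} (\<lambda>s. int (j s) - int (i s)) \<and>
     (\<forall>k\<in>{1..n}. lam k =
        (\<Sum>s=1..m. p s * std_basis (i s) k + q s * std_basis (j s) k)) \<and>
     (\<forall>s\<in>{1..m}. (p s * a (i s) + q s * a (j s)) / (p s + q s) = \<mu>)"

text \<open>
  With \<open>f\<close> and \<open>g\<close> counting outwards from the mean, \<open>j s - i s = f s + g s - 1\<close>. The weight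
  equation splits into its lower and upper coordinates because \<open>i\<close> only hits the former and \<open>j\<close>
  only the latter.
\<close>
lemma paired_decomposition_iff_staircase:
  fixes lam a p q t :: "nat \<Rightarrow> real" and \<mu> :: real
  assumes "z \<le> n"
    and below: "\<And>k. k \<in> {1..z} \<Longrightarrow> a k < \<mu>" and above: "\<And>k. k \<in> {z+1..n} \<Longrightarrow> \<mu> < a k"
    and pos: "\<And>s. s \<in> {1..m} \<Longrightarrow> p s > 0 \<and> q s > 0"
    and f: "\<And>s. s \<in> {1..m} \<Longrightarrow> f s \<in> {1..z}" and g: "\<And>s. s \<in> {1..m} \<Longrightarrow> g s \<in> {1..n-z}"
    and i: "\<And>s. s \<in> {1..m} \<Longrightarrow> i s = z + 1 - f s"
    and j: "\<And>s. s \<in> {1..m} \<Longrightarrow> j s = z + g s"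
    and t: "\<And>s. s \<in> {1..m} \<Longrightarrow> t s = p s * (\<mu> - a (i s))"
  shows "paired_decomposition n z lam a \<mu> m i j p q \<longleftrightarrow>
    (\<forall>s\<in>{1..m}. t s = q s * (a (j s) - \<mu>)) \<and>
    staircase m t z (\<lambda>k. lam (z + 1 - k) * (\<mu> - a (z + 1 - k))) f
      (n - z) (\<lambda>k. lam (z + k) * (a (z + k) - \<mu>)) g"
proof -
  have range: "i s \<in> {1..z} \<and> j s \<in> {z+1..n}" if "s \<in> {1..m}" for s
    using f[OF that] g[OF that] i[OF that] j[OF that] by auto
  have mean: "(p s * a (i s) + q s * a (j s)) / (p s + q s) = \<mu> \<longleftrightarrow> t s = q s * (a (j s) - \<mu>)"
    if "s \<in> {1..m}" for s
    using pos[OF that] t[OF that] by (auto simp: field_simps)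
  have anti: "antimono_on {1..m} i \<longleftrightarrow> mono_on {1..m} f"
  proof -
    have "i r \<ge> i s \<longleftrightarrow> f r \<le> f s" if "r \<in> {1..m}" "s \<in> {1..m}" for r s
      using f[OF that(1)] f[OF that(2)] i[OF that(1)] i[OF that(2)] by auto
    then show ?thesis unfolding monotone_on_def by blast
  qed
  have mono: "mono_on {1..m} j \<longleftrightarrow> mono_on {1..m} g"
    unfolding monotone_on_def using j by auto
  have strict: "strict_mono_on {1..m} (\<lambda>s. int (j s) - int (i s)) \<longleftrightarrow>
      strict_mono_on {1..m} (\<lambda>s. f s + g s)"
  proof -
    have diff: "int (j s) - int (i s) = int (f s + g s) - 1" if "s \<in> {1..m}" for s
      using f[OF that] i[OF that] j[OF that] by auto
    have "int (j r) - int (i r) < int (j s) - int (i s) \<longleftrightarrow> f r + g r < f s + g s"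
      if "r \<in> {1..m}" "s \<in> {1..m}" for r s
      using diff[OF that(1)] diff[OF that(2)] by linarith
    then show ?thesis unfolding monotone_on_def by blast
  qed
  have pick: "(\<Sum>s=1..m. w s * std_basis (h s) k) = sum w {s\<in>{1..m}. h s = k}"
    for w h k by (subst sum.inter_filter) (auto simp: std_basis_def intro!: sum.cong)
  have lower: "(\<Sum>s=1..m. p s * std_basis (i s) k + q s * std_basis (j s) k) =
      sum p {s\<in>{1..m}. i s = k}" if "k \<in> {1..z}" for k
  proof -
    have "{s\<in>{1..m}. j s = k} = {}" using range that by fastforce
    then show ?thesis unfolding sum.distrib pick by (simp only: sum.empty add_0_right)
  qed
  have upper: "(\<Sum>s=1..m. p s * std_basis (i s) k + q s * std_basis (j s) k) =
      sum q {s\<in>{1..m}. j s = k}" if "k \<in> {z+1..n}" for k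
  proof -
    have "{s\<in>{1..m}. i s = k} = {}" using range that by fastforce
    then show ?thesis unfolding sum.distrib pick by (simp only: sum.empty add_0_left)
  qed
  have split: "{1..n} = {1..z} \<union> {z+1..n}" using \<open>z \<le> n\<close> by auto
  have weights: "(\<forall>k\<in>{1..n}. lam k =
        (\<Sum>s=1..m. p s * std_basis (i s) k + q s * std_basis (j s) k)) \<longleftrightarrow>
      (\<forall>k\<in>{1..z}. lam k = sum p {s\<in>{1..m}. i s = k}) \<and>
      (\<forall>k\<in>{z+1..n}. lam k = sum q {s\<in>{1..m}. j s = k})"
    unfolding split ball_Un using lower upper by simp
  have fills_f: "fills m t z (\<lambda>k. lam (z + 1 - k) * (\<mu> - a (z + 1 - k))) f \<longleftrightarrow>
      i ` {1..m} = {1..z} \<and> mono_on {1..m} f \<and>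
      (\<forall>k\<in>{1..z}. lam k = sum p {s\<in>{1..m}. i s = k})"
  proof (rule fills_relabel[where c = "\<lambda>k. \<mu> - a k" and \<rho> = "\<lambda>k. z + 1 - k"])
    show "bij_betw (\<lambda>k. z + 1 - k) {1..z} {1..z}"
      by (rule bij_betw_byWitness[where f' = "\<lambda>k. z + 1 - k"]) auto
  qed (use f i t below in auto)
  have fills_g: "fills m t (n - z) (\<lambda>k. lam (z + k) * (a (z + k) - \<mu>)) g \<longleftrightarrow>
      j ` {1..m} = {z+1..n} \<and> mono_on {1..m} g \<and>
      (\<forall>k\<in>{z+1..n}. lam k = sum q {s\<in>{1..m}. j s = k})"
    if "\<forall>s\<in>{1..m}. t s = q s * (a (j s) - \<mu>)"
  proof (rule fills_relabel[where c = "\<lambda>k. a k - \<mu>" and \<rho> = "\<lambda>k. z + k"])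
    show "bij_betw (\<lambda>k. z + k) {1..n - z} {z+1..n}"
      by (rule bij_betw_byWitness[where f' = "\<lambda>k. k - z"]) auto
  qed (use g j above that in auto)
  show ?thesis
    unfolding paired_decomposition_def staircase_def anti mono strict weights fills_f
    using mean fills_g by auto
qed

text \<open>The moments about the mean add up to zero; separate those below from those above.\<close>
lemma balanced_about_weighted_mean:
  fixes lam a :: "nat \<Rightarrow> real"
  assumes "z \<le> n" and "(\<Sum>k=1..n. lam k) \<noteq> 0"
  defines "\<mu> \<equiv> weighted_mean n lam a"
  shows "(\<Sum>k=1..z. lam (z + 1 - k) * (\<mu> - a (z + 1 - k))) =
    (\<Sum>k=1..n-z. lam (z + k) * (a (z + k) - \<mu>))"
proof -
  have split: "{1..n} = {1..z} \<union> {z+1..n}" using \<open>z \<le> n\<close> by auto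
  have "(\<Sum>k=1..n. lam k * (a k - \<mu>)) = (\<Sum>k=1..n. lam k * a k) - \<mu> * (\<Sum>k=1..n. lam k)"
    by (simp add: right_diff_distrib sum_subtractf sum_distrib_left mult.commute)
  also have "\<dots> = 0" using assms(2) by (simp add: \<mu>_def weighted_mean_def)
  finally have "(\<Sum>k=1..z. lam k * (a k - \<mu>)) + (\<Sum>k=z+1..n. lam k * (a k - \<mu>)) = 0"
    unfolding split by (subst (asm) sum.union_disjoint) auto
  moreover have "(\<Sum>k=1..z. lam (z + 1 - k) * (\<mu> - a (z + 1 - k))) =
      - (\<Sum>k=1..z. lam k * (a k - \<mu>))"
    unfolding sum_negf [symmetric]
    by (rule sum.reindex_bij_witness[where i = "\<lambda>k. z + 1 - k" and j = "\<lambda>k. z + 1 - k"])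
      (auto simp: algebra_simps)
  moreover have "(\<Sum>k=1..n-z. lam (z + k) * (a (z + k) - \<mu>)) = (\<Sum>k=z+1..n. lam k * (a k - \<mu>))"
    by (rule sum.reindex_bij_witness[where i = "\<lambda>k. k - z" and j = "\<lambda>k. z + k"]) auto
  ultimately show ?thesis by linarith
qed

theorem theorem2p2:
  fixes n z :: nat and lam a :: "nat \<Rightarrow> real"
  assumes "n > 1"
    and "\<And>k. k \<in> {1..n} \<Longrightarrow> lam k > 0"
    and "1 \<le> z" and "z \<le> n - 1"
    and "strict_mono_on {1..z} a"
    and "a z < weighted_mean n lam a"
    and "weighted_mean n lam a < a (z + 1)"
    and "strict_mono_on {z+1..n} a"
  shows "\<exists>!(m :: nat, i :: nat \<Rightarrow> nat, j :: nat \<Rightarrow> nat, p :: nat \<Rightarrow> real, q :: nat \<Rightarrow> real).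
    real n / 2 + \<bar>real z - real n / 2\<bar> \<le> real m \<and> m \<le> n - 1 \<and>
    i \<in> {1..m} \<rightarrow>\<^sub>E {1..z} \<and> i ` {1..m} = {1..z} \<and>
    j \<in> {1..m} \<rightarrow>\<^sub>E {z+1..n} \<and> j ` {1..m} = {z+1..n} \<and>
    antimono_on {1..m} i \<and> mono_on {1..m} j \<and>
    strict_mono_on {1..m} (\<lambda>s. int (j s) - int (i s)) \<and>
    p \<in> {1..m} \<rightarrow>\<^sub>E {0<..} \<and> q \<in> {1..m} \<rightarrow>\<^sub>E {0<..} \<and>
    (\<forall>k\<in>{1..n}. lam k =
       (\<Sum>s=1..m. p s * std_basis (i s) k + q s * std_basis (j s) k)) \<and>
    (\<forall>s\<in>{1..m}. (p s * a (i s) + q s * a (j s)) / (p s + q s) = weighted_mean n lam a)"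
proof -
  define \<mu> where "\<mu> = weighted_mean n lam a"
  \<comment> \<open>\<open>x\<close> and \<open>y\<close> list the moments outwards from the mean, on the lower and on the upper side\<close>
  define x where "x k = lam (z + 1 - k) * (\<mu> - a (z + 1 - k))" for k
  define y where "y k = lam (z + k) * (a (z + k) - \<mu>)" for k
  define solution where "solution m i j p q \<longleftrightarrow>
    real n / 2 + \<bar>real z - real n / 2\<bar> \<le> real m \<and> m \<le> n - 1 \<and>
    i \<in> {1..m} \<rightarrow>\<^sub>E {1..z} \<and> j \<in> {1..m} \<rightarrow>\<^sub>E {z+1..n} \<and>
    p \<in> {1..m} \<rightarrow>\<^sub>E {0<..} \<and> q \<in> {1..m} \<rightarrow>\<^sub>E {0<..} \<and>
    paired_decomposition n z lam a \<mu> m i j p q" for m i j p q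
  have "z \<le> n" using assms(4) by simp
  have below: "a k < \<mu>" if "k \<in> {1..z}" for k
    using monotone_onD[OF assms(5) that, of z] that assms(3,6) by (cases "k = z") (auto simp: \<mu>_def)
  have above: "\<mu> < a k" if "k \<in> {z+1..n}" for k
    using monotone_onD[OF assms(8) _ that, of "z + 1"] that assms(7)
    by (cases "k = z + 1") (auto simp: \<mu>_def)
  have x: "x k > 0" if "k \<in> {1..z}" for k
  proof -
    have "z + 1 - k \<in> {1..z}" "z + 1 - k \<in> {1..n}" using that \<open>z \<le> n\<close> by auto
    then show ?thesis unfolding x_def using assms(2) below by (intro mult_pos_pos) auto
  qed
  have y: "y k > 0" if "k \<in> {1..n-z}" for k
    unfolding y_def using that assms(2)[of "z + k"] above[of "z + k"] by auto
  have "(\<Sum>k=1..n. lam k) > 0" using assms(1,2) by (intro sum_pos) auto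
  then have total: "sum x {1..z} = sum y {1..n-z}"
    unfolding x_def y_def \<mu>_def using balanced_about_weighted_mean[OF \<open>z \<le> n\<close>, of lam a] by simp

  obtain m t f g where t: "\<And>s. s \<in> {1..m} \<Longrightarrow> t s > 0" and st: "staircase m t z x f (n - z) y g"
    using staircase_exists[OF x y total] by blast
  have f: "f s \<in> {1..z}" and g: "g s \<in> {1..n-z}" if "s \<in> {1..m}" for s
    using st that by (auto simp: staircase_def fills_def)
  define i where "i = restrict (\<lambda>s. z + 1 - f s) {1..m}"
  define j where "j = restrict (\<lambda>s. z + g s) {1..m}"
  define p where "p = restrict (\<lambda>s. t s / (\<mu> - a (i s))) {1..m}"
  define q where "q = restrict (\<lambda>s. t s / (a (j s) - \<mu>)) {1..m}"
  have ij: "i s \<in> {1..z} \<and> j s \<in> {z+1..n}" if "s \<in> {1..m}" for s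
    using f[OF that] g[OF that] that by (auto simp: i_def j_def)
  have pq: "p s > 0 \<and> q s > 0 \<and> t s = p s * (\<mu> - a (i s)) \<and> t s = q s * (a (j s) - \<mu>)"
    if "s \<in> {1..m}" for s
    using below[of "i s"] above[of "j s"] ij[OF that] t[OF that] that by (auto simp: p_def q_def)
  then have pos: "p s > 0 \<and> q s > 0" and t_p: "t s = p s * (\<mu> - a (i s))"
    and t_q: "t s = q s * (a (j s) - \<mu>)" if "s \<in> {1..m}" for s
    using that by blast+
  have i: "i s = z + 1 - f s" and j: "j s = z + g s" if "s \<in> {1..m}" for s
    using that by (simp_all add: i_def j_def)
  have "paired_decomposition n z lam a \<mu> m i j p q"
    by (rule iffD2[OF paired_decomposition_iff_staircase[where f = f and g = g and i = i and j = j
          and p = p and t = t, OF \<open>z \<le> n\<close> below above pos f g i j t_p]])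
      (use t_q st in \<open>simp_all add: x_def[abs_def] y_def[abs_def]\<close>)
  \<comment> \<open>\<open>n / 2 + \<bar>z - n / 2\<bar>\<close> is the maximum of \<open>z\<close> and \<open>n - z\<close>\<close>
  moreover have "real n / 2 + \<bar>real z - real n / 2\<bar> \<le> real m" "m \<le> n - 1"
    using staircase_bounds[OF st] assms(4) by linarith+
  ultimately have sol: "solution m i j p q"
    using ij pq by (auto simp: solution_def i_def j_def p_def q_def)

  have unique: "m' = m \<and> i' = i \<and> j' = j \<and> p' = p \<and> q' = q" if sol': "solution m' i' j' p' q'"
    for m' i' j' p' q'
  proof -
    define f' where "f' s = z + 1 - i' s" for s
    define g' where "g' s = j' s - z" for s
    define t' where "t' s = p' s * (\<mu> - a (i' s))" for s
    have t'_p': "t' s = p' s * (\<mu> - a (i' s))" if "s \<in> {1..m'}" for s by (fact t'_def)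
    have i': "i' \<in> {1..m'} \<rightarrow>\<^sub>E {1..z}" and j': "j' \<in> {1..m'} \<rightarrow>\<^sub>E {z+1..n}"
      and p': "p' \<in> {1..m'} \<rightarrow>\<^sub>E {0<..}" and q': "q' \<in> {1..m'} \<rightarrow>\<^sub>E {0<..}"
      and pd: "paired_decomposition n z lam a \<mu> m' i' j' p' q'"
      using sol' by (auto simp: solution_def)
    have ij': "i' s \<in> {1..z} \<and> j' s \<in> {z+1..n}" and pq': "p' s > 0 \<and> q' s > 0"
      if "s \<in> {1..m'}" for s
      using PiE_mem[OF i' that] PiE_mem[OF j' that] PiE_mem[OF p' that] PiE_mem[OF q' that] by auto
    have fg': "f' s \<in> {1..z}" "g' s \<in> {1..n-z}" "i' s = z + 1 - f' s" "j' s = z + g' s"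
      if "s \<in> {1..m'}" for s
      using ij'[OF that] by (auto simp: f'_def g'_def)
    have t': "t' s > 0" if "s \<in> {1..m'}" for s
      using pq'[OF that] below ij'[OF that] by (simp add: t'_def)
    have "(\<forall>s\<in>{1..m'}. t' s = q' s * (a (j' s) - \<mu>)) \<and> staircase m' t' z x f' (n - z) y g'"
      using iffD1[OF paired_decomposition_iff_staircase[where f = f' and g = g' and i = i'
            and j = j' and p = p' and t = t', OF \<open>z \<le> n\<close> below above pq' fg' t'_p'] pd]
      by (simp add: x_def[abs_def] y_def[abs_def])
    then have t'_q': "\<And>s. s \<in> {1..m'} \<Longrightarrow> t' s = q' s * (a (j' s) - \<mu>)"
      and st': "staircase m' t' z x f' (n - z) y g'" by auto
    have m: "m' = m" and eq: "\<And>s. s \<in> {1..m} \<Longrightarrow> t' s = t s \<and> f' s = f s \<and> g' s = g s"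
      using staircase_unique[OF t' t x y st' st] by auto
    have ij_eq: "i' s = i s" "j' s = j s" if "s \<in> {1..m}" for s
      using fg'(3,4)[of s] eq[OF that] m that by (auto simp: i_def j_def)
    have pq_eq: "p' s = p s" "q' s = q s" if "s \<in> {1..m}" for s
    proof -
      have "p' s * (\<mu> - a (i s)) = p s * (\<mu> - a (i s))" "q' s * (a (j s) - \<mu>) = q s * (a (j s) - \<mu>)"
        using eq[OF that] pq[OF that] t'_def[of s] t'_q'[of s] ij_eq[OF that] m that by auto
      then show "p' s = p s" "q' s = q s"
        using below[of "i s"] above[of "j s"] ij[OF that] by auto
    qed
    have "i \<in> extensional {1..m}" "j \<in> extensional {1..m}" "p \<in> extensional {1..m}" "q \<in> extensional {1..m}"
      by (simp_all add: i_def j_def p_def q_def)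
    moreover have "i' \<in> extensional {1..m}" "j' \<in> extensional {1..m}"
      "p' \<in> extensional {1..m}" "q' \<in> extensional {1..m}"
      using i' j' p' q' m by (auto simp: PiE_def)
    ultimately show ?thesis
      using m ij_eq pq_eq by (blast intro: extensionalityI)
  qed
  have "\<exists>!(m, i, j, p, q). solution m i j p q"
  proof (rule ex1I[of _ "(m, i, j, p, q)"])
    show "case (m, i, j, p, q) of (m, i, j, p, q) \<Rightarrow> solution m i j p q" using sol by simp
    fix r assume "case r of (m, i, j, p, q) \<Rightarrow> solution m i j p q"
    then show "r = (m, i, j, p, q)"
      by (cases r) (simp only: prod.case prod.inject, rule unique)
  qed
  then show ?thesis
    \<comment> \<open>only the order of the conjuncts differs\<close>
    unfolding solution_def paired_decomposition_def \<mu>_def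
    by (elim back_subst[where P = Ex1], intro ext, unfold split_paired_all prod.case)
      (intro iffI; elim conjE; intro conjI; assumption)
qed

end
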